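(* Let $\alpha>0$ and $0<\gamma<1$, and let $\mathcal{F}$ be any one of the families $\mathcal{IF}$, $\mathcal{AP}$, $\mathcal{PS}$, $\mathcal{HSD}$, $\mathcal{J}$, $\mathcal{PUAD}$, $\mathcal{PUBD}$ of subsets of $\mathbb{N}$. If $A$ is an essential $\mathcal{F}$-set in $\mathbb{N}$, then $g_{\alpha,\gamma}[A]$ is an essential $\mathcal{F}$-set in $\mathbb{N}$.
   Context: $\mathbb{N}=\{1,2,3,\dots\}$; $\mathcal{P}_f(X)$ is the set of finite nonempty subsets of $X$. For $\alpha>0$ and $0<\gamma<1$, $g_{\alpha,\gamma}(n)=\lfloor \alpha n+\gamma\rfloor$ for $n\in\mathbb{N}$; for $A\subseteq\mathbb{N}$, $g_{\alpha,\gamma}[A]=\{g_{\alpha,\gamma}(n):n\in A\}\cap\mathbb{N}$ (a value $0$, which can occur for finitely many $n$ when $\alpha$ is small, is discarded). Families of subsets $A$ of $\mathbb{N}$: - $\mathcal{IF}$: infinite sets. - $\mathcal{AP}$: sets containing arithmetic progressions (nonzero common difference) of arbitrary finite length. - $\mathcal{PS}$: piecewise syndetic sets, i.e. there is $G\in\mathcal{P}_f(\mathbb{N})$ such that for every $F\in\mathcal{P}_f(\mathbb{N})$ there is $x\in\mathbb{N}$ with $F+x\subseteq\bigcup_{t\in G}(-t+A)$, where $-t+A=\{s\in\mathbb{N}:t+s\in A\}$. - $\mathcal{HSD}$: sets with $\sum_{n\in A}\frac1n=\infty$. - $\mathcal{J}$: $J$-sets, i.e. for every finite nonempty set $F$ of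 sequences $f:\mathbb{N}\to\mathbb{N}$ there are $a\in\mathbb{N}$ and $H\in\mathcal{P}_f(\mathbb{N})$ with $a+\sum_{n\in H}f(n)\in A$ for all $f\in F$. - $\mathcal{PUAD}$: sets with $\overline{d}(A)=\limsup_{n\to\infty}\frac{|A\cap\{1,\dots,n\}|}{n}>0$. - $\mathcal{PUBD}$: sets with $d^{\star}(A)=\limsup_{n-m\to\infty}\frac{|A\cap\{m+1,\dots,n\}|}{n-m}>0$. Each of these is a nonempty upward hereditary collection of nonempty sets with the Ramsey property (if a member is a union of two sets, one of them is a member). $\beta\mathbb{N}$ is the set of ultrafilters on $\mathbb{N}$ with the operation $A\in p+q\iff\{x\in\mathbb{N}:-x+A\in q\}\in p$. Put $\beta(\mathcal{F})=\{p\in\beta\mathbb{N}:p\subseteq\mathcal{F}\}$, which is a subsemigroup of $\beta\mathbb{N}$ for each of these families. $A\subseteq\mathbb{N}$ is an essential $\mathcal{F}$-set if $A\in p$ for some idempotent $p=p+p$ in $\beta(\mathcal{F})$. *)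

theory Defs
  imports "HOL-Analysis.Analysis"
begin

text \<open>
  The set of natural numbers of the paper is \<open>{1, 2, 3, \<dots>}\<close>. It is rendered as the
  subset \<open>pos_nats\<close> of the type \<^typ>\<open>nat\<close>; all families and ultrafilters below consist
  of subsets of it.
\<close>

definition pos_nats :: "nat set" where
  "pos_nats = {0<..}"

definition fin_subsets :: "'a set \<Rightarrow> 'a set set" where
  "fin_subsets X = {F. F \<subseteq> X \<and> finite F \<and> F \<noteq> {}}"

definition left_translate :: "nat \<Rightarrow> nat set \<Rightarrow> nat set" where
  "left_translate t A = {s \<in> pos_nats. t + s \<in> A}"

definition IF_sets :: "nat set set" where
  "IF_sets = {A. A \<subseteq> pos_nats \<and> infinite A}"

definition AP_sets :: "nat set set" where
  "AP_sets = {A. A \<subseteq> pos_nats \<and>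
     (\<forall>k. \<exists>a\<in>pos_nats. \<exists>d\<in>pos_nats. \<forall>i<k. a + i * d \<in> A)}"

definition PS_sets :: "nat set set" where
  "PS_sets = {A. A \<subseteq> pos_nats \<and>
     (\<exists>G\<in>fin_subsets pos_nats. \<forall>F\<in>fin_subsets pos_nats. \<exists>x\<in>pos_nats.
        (\<lambda>s. s + x) ` F \<subseteq> (\<Union>t\<in>G. left_translate t A))}"

text \<open>The sum is taken in \<^typ>\<open>ennreal\<close>, where it always exists.\<close>

definition HSD_sets :: "nat set set" where
  "HSD_sets = {A. A \<subseteq> pos_nats \<and> (\<Sum>\<^sub>\<infinity>n\<in>A. ennreal (1 / real n)) = \<infinity>}"

text \<open>
  A sequence of positive naturals is a function on \<^typ>\<open>nat\<close> mapping \<open>pos_nats\<close> to itself; its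
  value at \<open>0\<close> is never used.
\<close>

definition J_sets :: "nat set set" where
  "J_sets = {A. A \<subseteq> pos_nats \<and>
     (\<forall>F\<in>fin_subsets (pos_nats \<rightarrow> pos_nats). \<exists>a\<in>pos_nats. \<exists>H\<in>fin_subsets pos_nats.
        \<forall>f\<in>F. a + (\<Sum>n\<in>H. f n) \<in> A)}"

definition upper_density :: "nat set \<Rightarrow> ereal" where
  "upper_density A = limsup (\<lambda>n. ereal (real (card (A \<inter> {1..n})) / real n))"

text \<open>
  The limit superior for \<open>n - m \<rightarrow> \<infinity>\<close> is taken along the filter on pairs \<open>(m, n)\<close> of positive
  naturals generated by the sets \<open>{(m, n). n - m \<ge> k}\<close>.
\<close>

definition upper_Banach_density :: "nat set \<Rightarrow> ereal" where
  "upper_Banach_density A =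
     Limsup (inf (filtercomap (\<lambda>(m, n). int n - int m) at_top) (principal (pos_nats \<times> pos_nats)))
       (\<lambda>(m, n). ereal (real (card (A \<inter> {m+1..n})) / (real n - real m)))"

definition PUAD_sets :: "nat set set" where
  "PUAD_sets = {A. A \<subseteq> pos_nats \<and> upper_density A > 0}"

definition PUBD_sets :: "nat set set" where
  "PUBD_sets = {A. A \<subseteq> pos_nats \<and> upper_Banach_density A > 0}"

text \<open>The underlying set of the Stone--Cech compactification of \<open>pos_nats\<close>.\<close>

definition beta_pos_nats :: "nat set set set" where
  "beta_pos_nats = {p. p \<subseteq> Pow pos_nats \<and> pos_nats \<in> p \<and> {} \<notin> p \<and>
     (\<forall>A\<in>p. \<forall>B\<in>p. A \<inter> B \<in> p) \<and>
     (\<forall>A\<in>p. \<forall>B. A \<subseteq> B \<and> B \<subseteq> pos_nats \<longrightarrow> B \<in> p) \<and>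
     (\<forall>A. A \<subseteq> pos_nats \<longrightarrow> A \<in> p \<or> pos_nats - A \<in> p)}"

definition ultrafilter_add :: "nat set set \<Rightarrow> nat set set \<Rightarrow> nat set set" where
  "ultrafilter_add p q =
     {A. A \<subseteq> pos_nats \<and> {x \<in> pos_nats. left_translate x A \<in> q} \<in> p}"

definition beta_family :: "nat set set \<Rightarrow> nat set set set" where
  "beta_family \<F> = {p \<in> beta_pos_nats. p \<subseteq> \<F>}"

definition essential_set :: "nat set set \<Rightarrow> nat set \<Rightarrow> bool" where
  "essential_set \<F> A \<longleftrightarrow>
     A \<subseteq> pos_nats \<and> (\<exists>p\<in>beta_family \<F>. ultrafilter_add p p = p \<and> A \<in> p)"

text \<open>
  For \<open>\<alpha> > 0\<close> and \<open>\<gamma> > 0\<close> the floor is nonnegative, so \<^const>\<open>nat\<close> does not truncate.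
\<close>

definition spectrum_fun :: "real \<Rightarrow> real \<Rightarrow> nat \<Rightarrow> nat" where
  "spectrum_fun \<alpha> \<gamma> n = nat \<lfloor>\<alpha> * real n + \<gamma>\<rfloor>"

definition spectrum_image :: "real \<Rightarrow> real \<Rightarrow> nat set \<Rightarrow> nat set" where
  "spectrum_image \<alpha> \<gamma> A = spectrum_fun \<alpha> \<gamma> ` A \<inter> pos_nats"

end

theory Submission
  imports Defs
begin

text \<open>
  Write \<open>g n = \<lfloor>\<alpha> n + \<gamma>\<rfloor>\<close>, let \<open>p\<close> be an idempotent ultrafilter all of whose members lie in \<open>\<F>\<close>,
  and let \<open>A \<in> p\<close>. The witness for the image of \<open>A\<close> is the image ultrafilter
  \<open>q = {C. g\<^sup>-\<^sup>1 C \<in> p}\<close>, which visibly contains \<open>g[A]\<close>.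

  Passing to the limit along \<open>p\<close> in the circle, \<open>\<alpha> n\<close> tends to an idempotent of the circle group,
  that is, to \<open>0\<close>. Hence for each \<open>\<epsilon> > 0\<close> the set of \<open>n\<close> for which \<open>\<alpha> n\<close> is within \<open>\<epsilon>\<close> of an
  integer belongs to \<open>p\<close> (\<open>idempotent_near_integers\<close>), and because \<open>0 < \<gamma> < 1\<close> that integer is
  \<open>g n\<close> once \<open>\<epsilon>\<close> is small (\<open>near_integer_in_idempotent\<close>). On such a set \<open>g\<close> is additive,
  so \<open>q\<close> is idempotent together with \<open>p\<close> (\<open>image_ultrafilter_idempotent\<close>).

  It remains to see that the members of \<open>q\<close> lie in \<open>\<F>\<close>. A member \<open>C\<close> of \<open>q\<close> contains \<open>g[D]\<close> for
  some \<open>D \<in> p\<close> on which \<open>\<alpha> n\<close> is within \<open>1/4\<close> of \<open>g n\<close>, so it is enough that \<open>g\<close> carries such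
  members \<open>D\<close> of \<open>\<F>\<close> into \<open>\<F>\<close> (\<open>essential_image\<close>). For infinite sets, divergent harmonic sums and
  the two densities this holds because \<open>g\<close> is monotone, grows linearly and is boundedly
  many-to-one; for piecewise syndetic sets because \<open>g\<close> distorts gaps by a bounded factor. An
  arithmetic progression in \<open>D\<close> goes to one, since rounding errors below \<open>1/4\<close> cannot make two
  consecutive integer differences unequal.

  The \<open>J\<close>-sets need a different idea (\<open>J_preserved\<close>): given sequences \<open>f\<close>, one would like to
  apply the \<open>J\<close>-property of \<open>D\<close> to \<open>f / \<alpha>\<close>. By the pigeonhole principle the sums of \<open>f / \<alpha>\<close> over
  suitable disjoint blocks are as close to integers as desired, simultaneously for finitely many
  \<open>f\<close>. Rounding these block sums gives the sequences to which the \<open>J\<close>-property of \<open>D\<close> is applied.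
\<close>

section \<open>Ultrafilters on the positive integers\<close>

lemma beta_upward:
  assumes "p \<in> beta_pos_nats" "A \<in> p" "A \<subseteq> B" "B \<subseteq> pos_nats"
  shows "B \<in> p"
proof -
  have "\<forall>A\<in>p. \<forall>B. A \<subseteq> B \<and> B \<subseteq> pos_nats \<longrightarrow> B \<in> p"
    using assms(1) by (simp add: beta_pos_nats_def)
  then show ?thesis using assms(2-4) by blast
qed

lemma beta_Int:
  assumes "p \<in> beta_pos_nats" "A \<in> p" "B \<in> p"
  shows "A \<inter> B \<in> p"
  using assms by (simp add: beta_pos_nats_def)

lemma beta_nonempty:
  assumes "p \<in> beta_pos_nats" "A \<in> p"
  shows "\<exists>x. x \<in> A"
proof -
  have "{} \<notin> p" using assms(1) by (simp add: beta_pos_nats_def)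
  then show ?thesis using assms(2) by (cases "A = {}") auto
qed

lemma beta_subset_pos:
  assumes "p \<in> beta_pos_nats" "A \<in> p"
  shows "A \<subseteq> pos_nats"
proof -
  have "p \<subseteq> Pow pos_nats" using assms(1) by (simp add: beta_pos_nats_def)
  then show ?thesis using assms(2) by blast
qed

lemma beta_Compl_iff:
  assumes p: "p \<in> beta_pos_nats" and "A \<subseteq> pos_nats"
  shows "pos_nats - A \<in> p \<longleftrightarrow> A \<notin> p"
proof
  assume 1: "pos_nats - A \<in> p"
  show "A \<notin> p"
  proof
    assume "A \<in> p"
    from beta_nonempty[OF p beta_Int[OF p 1 this]] show False by blast
  qed
next
  have "A \<in> p \<or> pos_nats - A \<in> p" using assms by (simp add: beta_pos_nats_def)
  moreover assume "A \<notin> p"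
  ultimately show "pos_nats - A \<in> p" by blast
qed

text \<open>
  Membership in \<open>p\<close> may be tested modulo any member \<open>Z\<close> of \<open>p\<close>; this is how identities that hold
  only on a large set are used below.
\<close>

lemma beta_cong:
  assumes p: "p \<in> beta_pos_nats" and Z: "Z \<in> p" and "A \<subseteq> pos_nats" "B \<subseteq> pos_nats"
    and eq: "\<And>x. x \<in> Z \<Longrightarrow> x \<in> A \<longleftrightarrow> x \<in> B"
  shows "A \<in> p \<longleftrightarrow> B \<in> p"
proof -
  have *: "Y \<in> p" if "X \<in> p" "X \<inter> Z \<subseteq> Y" "Y \<subseteq> pos_nats" for X Y
    using beta_upward[OF p beta_Int[OF p that(1) Z] that(2,3)] .
  show ?thesis using *[of A B] *[of B A] assms by blast
qed

lemma beta_finite_UN: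
  assumes p: "p \<in> beta_pos_nats" and "finite I"
    and "\<And>i. i \<in> I \<Longrightarrow> A i \<subseteq> pos_nats" and "(\<Union>i\<in>I. A i) \<in> p"
  shows "\<exists>i\<in>I. A i \<in> p"
proof (rule ccontr)
  assume none: "\<not> (\<exists>i\<in>I. A i \<in> p)"
  have "J \<subseteq> I \<Longrightarrow> pos_nats - (\<Union>i\<in>J. A i) \<in> p" if "finite J" for J
    using that
  proof (induction J)
    case empty
    show ?case using p by (simp add: beta_pos_nats_def)
  next
    case (insert j J)
    have "pos_nats - A j \<in> p"
      using insert.prems none by (subst beta_Compl_iff[OF p assms(3)]) auto
    moreover have "pos_nats - (\<Union>i\<in>J. A i) \<in> p" using insert by blast
    ultimately have "(pos_nats - A j) \<inter> (pos_nats - (\<Union>i\<in>J. A i)) \<in> p"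
      by (rule beta_Int[OF p])
    then show ?case by (simp add: Diff_Un)
  qed
  from this[OF assms(2) subset_refl] have "pos_nats - (\<Union>i\<in>I. A i) \<in> p" .
  moreover have "(\<Union>i\<in>I. A i) \<subseteq> pos_nats" using assms(3) by auto
  ultimately show False using beta_Compl_iff[OF p, of "\<Union>i\<in>I. A i"] assms(4) by simp
qed

section \<open>Idempotent ultrafilters\<close>

text \<open>
  The set of \<open>x\<close> with \<open>-x + A \<in> p\<close> is itself in \<open>p\<close>, hence meets \<open>A\<close>.
\<close>

lemma idempotent_shift:
  assumes p: "p \<in> beta_pos_nats" and idem: "ultrafilter_add p p = p" and A: "A \<in> p"
  shows "\<exists>x\<in>A. left_translate x A \<in> p"
proof -
  have "{x \<in> pos_nats. left_translate x A \<in> p} \<in> p"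
    using A by (subst (asm) idem[symmetric]) (simp add: ultrafilter_add_def)
  from beta_nonempty[OF p beta_Int[OF p A this]] show ?thesis by blast
qed

text \<open>
  A finite member of an ultrafilter makes it principal, at \<open>x\<close> say; but then \<open>p + p\<close> is principal at
  \<open>2 x \<noteq> x\<close>.
\<close>

lemma idempotent_notin_finite:
  assumes p: "p \<in> beta_pos_nats" and idem: "ultrafilter_add p p = p" and "finite A"
  shows "A \<notin> p"
proof
  assume A: "A \<in> p"
  then have "(\<Union>x\<in>A. {x}) \<in> p" by simp
  then obtain x where x: "{x} \<in> p"
    using beta_finite_UN[OF p \<open>finite A\<close>, of "\<lambda>x. {x}"] beta_subset_pos[OF p A] by auto
  from idempotent_shift[OF p idem this] have "left_translate x {x} \<in> p" by blast
  moreover have "left_translate x {x} = {}"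
    by (auto simp: left_translate_def pos_nats_def)
  ultimately show False using beta_nonempty[OF p, of "{}"] by simp
qed

lemma abs_diff_less_of_floor_mult_eq:
  fixes x y K :: real
  assumes "\<lfloor>K * x\<rfloor> = \<lfloor>K * y\<rfloor>" "K > 0"
  shows "\<bar>x - y\<bar> < 1 / K"
proof -
  have "\<bar>K * x - K * y\<bar> < 1" using assms(1) by linarith
  then have "K * \<bar>x - y\<bar> < 1" using assms(2) by (simp add: right_diff_distrib[symmetric] abs_mult)
  then show ?thesis using assms(2) by (simp add: field_simps)
qed

lemma floor_mult_frac_in:
  assumes "K > (0::nat)"
  shows "\<lfloor>real K * frac x\<rfloor> \<in> {0..<int K}"
proof -
  have "real K * frac x < real K * 1"
    by (rule mult_strict_left_mono) (use assms frac_lt_1 in auto)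
  then show ?thesis by (auto simp: floor_less_iff)
qed

text \<open>
  The limit of \<open>\<alpha> n\<close> modulo \<open>1\<close> along \<open>p\<close> is an idempotent of the circle group. Instead of forming the
  limit, the circle is cut into arcs of length \<open>1/K\<close>: for one arc the set \<open>C\<close> of \<open>n\<close> with \<open>\<alpha> n\<close> in that
  arc belongs to \<open>p\<close>, and if \<open>x\<close> and \<open>x + n\<close> both lie in \<open>C\<close>, then \<open>\<alpha> n = \<alpha> (x + n) - \<alpha> x\<close> is within
  \<open>1/K\<close> of an integer.
\<close>

lemma idempotent_near_integers:
  fixes \<alpha> \<epsilon> :: real
  assumes p: "p \<in> beta_pos_nats" and idem: "ultrafilter_add p p = p" and "\<epsilon> > 0"
  shows "{n \<in> pos_nats. \<exists>k::int. \<bar>\<alpha> * real n - of_int k\<bar> < \<epsilon>} \<in> p"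
proof -
  obtain K :: nat where K: "K > 0" "1 / real K < \<epsilon>"
    using \<open>\<epsilon> > 0\<close> by (metis nat_approx_posE zero_less_Suc)
  define C where "C j = {n \<in> pos_nats. \<lfloor>real K * frac (\<alpha> * real n)\<rfloor> = j}" for j
  have "(\<Union>j\<in>{0..<int K}. C j) = pos_nats"
    using floor_mult_frac_in[OF K(1)] by (auto simp: C_def)
  then have "(\<Union>j\<in>{0..<int K}. C j) \<in> p" using p by (simp add: beta_pos_nats_def)
  then obtain j where j: "C j \<in> p"
    using beta_finite_UN[OF p, of "{0..<int K}" C] by (auto simp: C_def)
  from idempotent_shift[OF p idem j] obtain x where x: "x \<in> C j" "left_translate x (C j) \<in> p"
    by blast
  have "left_translate x (C j) \<subseteq> {n \<in> pos_nats. \<exists>k::int. \<bar>\<alpha> * real n - of_int k\<bar> < \<epsilon>}"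
  proof
    fix n assume n: "n \<in> left_translate x (C j)"
    then have "n \<in> pos_nats" and "x + n \<in> C j" by (auto simp: left_translate_def)
    then have "\<lfloor>real K * frac (\<alpha> * real (x + n))\<rfloor> = \<lfloor>real K * frac (\<alpha> * real x)\<rfloor>"
      using x by (auto simp: C_def)
    from abs_diff_less_of_floor_mult_eq[OF this] K
    have "\<bar>frac (\<alpha> * real (x + n)) - frac (\<alpha> * real x)\<bar> < \<epsilon>" by simp
    then have "\<bar>\<alpha> * real n - of_int (\<lfloor>\<alpha> * real (x + n)\<rfloor> - \<lfloor>\<alpha> * real x\<rfloor>)\<bar> < \<epsilon>"
      by (simp add: frac_def algebra_simps)
    with \<open>n \<in> pos_nats\<close> show "n \<in> {n \<in> pos_nats. \<exists>k::int. \<bar>\<alpha> * real n - of_int k\<bar> < \<epsilon>}" by blast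
  qed
  from beta_upward[OF p x(2) this] show ?thesis by blast
qed

section \<open>The function \<open>\<lfloor>\<alpha> n + \<gamma>\<rfloor>\<close>\<close>

locale spectrum =
  fixes \<alpha> \<gamma> :: real
  assumes \<alpha>: "\<alpha> > 0" and \<gamma>: "0 < \<gamma>" "\<gamma> < 1"
begin

abbreviation g :: "nat \<Rightarrow> nat" where "g \<equiv> spectrum_fun \<alpha> \<gamma>"

text \<open>
  Shifting the argument by this amount raises \<open>\<alpha> n\<close> by at least \<open>1\<close>, hence strictly raises \<open>g n\<close>.
\<close>

definition period :: nat where "period = nat \<lceil>1 / \<alpha>\<rceil>"

lemma period: "period > 0" "\<alpha> * real period \<ge> 1"
proof -
  have "1 / \<alpha> \<le> real period" unfolding period_def by linarith
  then show "\<alpha> * real period \<ge> 1" using \<alpha> by (simp add: field_simps)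
  then show "period > 0" by (cases "period = 0") auto
qed

lemma of_nat_g: "real (g n) = of_int \<lfloor>\<alpha> * real n + \<gamma>\<rfloor>"
proof -
  have "\<alpha> * real n + \<gamma> \<ge> 0" using \<alpha> \<gamma> by simp
  then show ?thesis by (simp add: spectrum_fun_def)
qed

lemma g_bounds: "real (g n) \<le> \<alpha> * real n + \<gamma>" "\<alpha> * real n + \<gamma> < real (g n) + 1"
  unfolding of_nat_g by linarith+

lemma g_mono: "m \<le> n \<Longrightarrow> g m \<le> g n"
  unfolding spectrum_fun_def using \<alpha> by (intro nat_mono floor_mono) simp

lemma g_shift_period: "g n + j \<le> g (n + period * j)"
proof -
  have "real j * 1 \<le> real j * (\<alpha> * real period)" using period by (intro mult_left_mono) auto
  then have "real (g n) + real j < real (g (n + period * j)) + 1"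
    using g_bounds(1)[of n] g_bounds(2)[of "n + period * j"] by (simp add: algebra_simps)
  then show ?thesis by linarith
qed

lemma g_le: "n > 0 \<Longrightarrow> real (g n) \<le> (\<alpha> + 1) * real n"
  using g_bounds(1)[of n] \<gamma> by (simp add: algebra_simps)

text \<open>
  Two arguments in the same residue class modulo \<open>period\<close> differ by a multiple of it, so \<open>g\<close>
  separates them. This expresses, in a form convenient for counting and summing, that each value of
  \<open>g\<close> is taken at most \<open>period\<close> times.
\<close>

lemma inj_g_mod: "inj (\<lambda>n. (g n, n mod period))"
proof (rule injI)
  have *: "m = n" if "m \<le> n" "g m = g n" "m mod period = n mod period" for m n
  proof -
    have "period dvd n - m" using that mod_eq_dvd_iff_nat[of m n period] by simp
    then obtain j where "n - m = period * j" by (elim dvdE)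
    then have j: "n = m + period * j" using \<open>m \<le> n\<close> by simp
    show ?thesis using g_shift_period[of m j] that j by simp
  qed
  fix m n assume "(g m, m mod period) = (g n, n mod period)"
  then show "m = n" using *[of m n] *[of n m] by (cases "m \<le> n") auto
qed

lemma finite_of_finite_image: "finite (g ` D) \<Longrightarrow> finite D"
proof -
  assume "finite (g ` D)"
  then have "finite (g ` D \<times> {..<period})" by simp
  moreover have "(\<lambda>n. (g n, n mod period)) ` D \<subseteq> g ` D \<times> {..<period}" using period by auto
  ultimately have "finite ((\<lambda>n. (g n, n mod period)) ` D)" by (rule rev_finite_subset)
  then show "finite D" by (rule finite_imageD) (rule inj_on_subset[OF inj_g_mod subset_UNIV])
qed

lemma card_le_period_mult_image:
  assumes "finite E" "g ` D \<subseteq> E"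
  shows "card D \<le> period * card E"
proof -
  have "card D = card ((\<lambda>n. (g n, n mod period)) ` D)"
    by (rule card_image[symmetric]) (rule inj_on_subset[OF inj_g_mod subset_UNIV])
  also have "\<dots> \<le> card (E \<times> {..<period})"
    using assms period by (intro card_mono) auto
  finally show ?thesis by (simp add: card_cartesian_product mult.commute)
qed

section \<open>The image of an idempotent ultrafilter\<close>

definition near_integer :: "real \<Rightarrow> nat set" where
  "near_integer \<epsilon> = {n \<in> pos_nats. \<bar>\<alpha> * real n - real (g n)\<bar> < \<epsilon>}"

text \<open>
  An integer at distance less than \<open>min \<gamma> (1 - \<gamma>)\<close> from \<open>\<alpha> n\<close> is \<open>g n\<close>; this is where
  \<open>0 < \<gamma> < 1\<close> enters.
\<close>

lemma near_integer_in_idempotent: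
  assumes p: "p \<in> beta_pos_nats" and idem: "ultrafilter_add p p = p" and "\<epsilon> > 0"
  shows "near_integer \<epsilon> \<in> p"
proof -
  define \<delta> where "\<delta> = min \<epsilon> (min \<gamma> (1 - \<gamma>))"
  have "\<delta> > 0" using assms \<gamma> by (simp add: \<delta>_def)
  have "{n \<in> pos_nats. \<exists>k::int. \<bar>\<alpha> * real n - of_int k\<bar> < \<delta>} \<subseteq> near_integer \<epsilon>"
  proof
    fix n assume "n \<in> {n \<in> pos_nats. \<exists>k::int. \<bar>\<alpha> * real n - of_int k\<bar> < \<delta>}"
    then obtain k :: int where n: "n \<in> pos_nats" and k: "\<bar>\<alpha> * real n - of_int k\<bar> < \<delta>" by blast
    have "\<lfloor>\<alpha> * real n + \<gamma>\<rfloor> = k" using k unfolding \<delta>_def by linarith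
    then show "n \<in> near_integer \<epsilon>" using n k by (simp add: near_integer_def of_nat_g \<delta>_def)
  qed
  from beta_upward[OF p idempotent_near_integers[OF p idem \<open>\<delta> > 0\<close>] this]
  show ?thesis by (simp add: near_integer_def)
qed

text \<open>
  The two errors add up to less than \<open>min \<gamma> (1 - \<gamma>)\<close>, so \<open>g m + g n\<close> is the integer that
  \<open>\<lfloor>\<alpha> (m + n) + \<gamma>\<rfloor>\<close> picks out.
\<close>

lemma g_add_near_integer:
  assumes "m \<in> near_integer \<epsilon>" "n \<in> near_integer \<epsilon>" and "2 * \<epsilon> \<le> min \<gamma> (1 - \<gamma>)"
  shows "g (m + n) = g m + g n"
proof -
  have "\<bar>\<alpha> * real m - real (g m)\<bar> < \<epsilon>" "\<bar>\<alpha> * real n - real (g n)\<bar> < \<epsilon>"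
    using assms by (auto simp: near_integer_def)
  moreover have "\<alpha> * real (m + n) - real (g m + g n)
      = (\<alpha> * real m - real (g m)) + (\<alpha> * real n - real (g n))"
    by (simp add: algebra_simps)
  ultimately have "\<bar>\<alpha> * real (m + n) - real (g m + g n)\<bar> < min \<gamma> (1 - \<gamma>)"
    using assms(3) by linarith
  then have "\<lfloor>\<alpha> * real (m + n) + \<gamma>\<rfloor> = int (g m + g n)" by linarith
  then show ?thesis by (subst (1) spectrum_fun_def) (simp only: nat_int)
qed

lemma g_pos_in_idempotent:
  assumes p: "p \<in> beta_pos_nats" and idem: "ultrafilter_add p p = p"
  shows "{n \<in> pos_nats. g n > 0} \<in> p"
proof -
  have "{n \<in> pos_nats. g n = 0} \<notin> p"
  proof (rule idempotent_notin_finite[OF p idem])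
    have "finite (g ` {n \<in> pos_nats. g n = 0})" by (rule finite_subset[of _ "{0}"]) auto
    then show "finite {n \<in> pos_nats. g n = 0}" by (rule finite_of_finite_image)
  qed
  moreover have "pos_nats - {n \<in> pos_nats. g n = 0} = {n \<in> pos_nats. g n > 0}" by auto
  ultimately show ?thesis using beta_Compl_iff[OF p, of "{n \<in> pos_nats. g n = 0}"] by auto
qed

definition image_ultrafilter :: "nat set set \<Rightarrow> nat set set" where
  "image_ultrafilter p = {C. C \<subseteq> pos_nats \<and> {n \<in> pos_nats. g n \<in> C} \<in> p}"

lemma image_ultrafilter_in_beta:
  assumes p: "p \<in> beta_pos_nats" and idem: "ultrafilter_add p p = p"
  shows "image_ultrafilter p \<in> beta_pos_nats"
  unfolding beta_pos_nats_def
proof (intro CollectI conjI ballI allI impI)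
  have pos: "{n \<in> pos_nats. g n \<in> pos_nats} \<in> p"
    using g_pos_in_idempotent[OF assms] by (simp add: pos_nats_def)
  show "image_ultrafilter p \<subseteq> Pow pos_nats" by (auto simp: image_ultrafilter_def)
  show "pos_nats \<in> image_ultrafilter p" using pos by (simp add: image_ultrafilter_def)
  show "{} \<notin> image_ultrafilter p" using beta_nonempty[OF p, of "{}"] by (auto simp: image_ultrafilter_def)
  fix C assume C: "C \<in> image_ultrafilter p"
  show "C \<inter> E \<in> image_ultrafilter p" if E: "E \<in> image_ultrafilter p" for E
  proof -
    have "{n \<in> pos_nats. g n \<in> C} \<inter> {n \<in> pos_nats. g n \<in> E} \<in> p"
      using C E beta_Int[OF p] by (simp add: image_ultrafilter_def)
    moreover have "{n \<in> pos_nats. g n \<in> C} \<inter> {n \<in> pos_nats. g n \<in> E} = {n \<in> pos_nats. g n \<in> C \<inter> E}"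
      by auto
    ultimately show ?thesis using C by (auto simp: image_ultrafilter_def)
  qed
  show "E \<in> image_ultrafilter p" if "C \<subseteq> E \<and> E \<subseteq> pos_nats" for E
    using C that beta_upward[OF p, of "{n \<in> pos_nats. g n \<in> C}" "{n \<in> pos_nats. g n \<in> E}"]
    by (auto simp: image_ultrafilter_def)
next
  fix C assume C: "C \<subseteq> pos_nats"
  have pos: "{n \<in> pos_nats. g n \<in> pos_nats} \<in> p"
    using g_pos_in_idempotent[OF assms] by (simp add: pos_nats_def)
  have "{n \<in> pos_nats. g n \<in> pos_nats - C} \<in> p \<longleftrightarrow> pos_nats - {n \<in> pos_nats. g n \<in> C} \<in> p"
    by (rule beta_cong[OF p pos]) auto
  then show "C \<in> image_ultrafilter p \<or> pos_nats - C \<in> image_ultrafilter p"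
    using C beta_Compl_iff[OF p, of "{n \<in> pos_nats. g n \<in> C}"] by (auto simp: image_ultrafilter_def)
qed

text \<open>
  For \<open>n\<close> and \<open>m\<close> in the member \<open>Z\<close> of \<open>p\<close>, where \<open>g\<close> is additive and positive, the conditions
  \<open>g n + g m \<in> C\<close> and \<open>g (n + m) \<in> C\<close> agree. The first one, for \<open>p\<close>-many \<open>n\<close> and \<open>p\<close>-many \<open>m\<close>, says
  that \<open>C\<close> belongs to the sum of the image with itself; the second one that \<open>g\<^sup>-\<^sup>1 C\<close> belongs to
  \<open>p + p = p\<close>.
\<close>

lemma image_ultrafilter_idempotent:
  assumes p: "p \<in> beta_pos_nats" and idem: "ultrafilter_add p p = p"
  shows "ultrafilter_add (image_ultrafilter p) (image_ultrafilter p) = image_ultrafilter p"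
proof -
  define \<epsilon> where "\<epsilon> = min \<gamma> (1 - \<gamma>) / 2"
  have \<epsilon>: "\<epsilon> > 0" "2 * \<epsilon> \<le> min \<gamma> (1 - \<gamma>)" using \<gamma> by (auto simp: \<epsilon>_def)
  define Z where "Z = near_integer \<epsilon> \<inter> {n \<in> pos_nats. g n > 0}"
  have Z: "Z \<in> p"
    unfolding Z_def by (intro beta_Int near_integer_in_idempotent g_pos_in_idempotent assms \<epsilon>)
  have "C \<in> ultrafilter_add (image_ultrafilter p) (image_ultrafilter p) \<longleftrightarrow> C \<in> image_ultrafilter p" if C: "C \<subseteq> pos_nats" for C
  proof -
    let ?G = "{n \<in> pos_nats. g n \<in> C}"
    have inner: "left_translate (g n) C \<in> image_ultrafilter p \<longleftrightarrow> left_translate n ?G \<in> p" if n: "n \<in> Z" for n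
    proof -
      have "{m \<in> pos_nats. g m \<in> left_translate (g n) C} \<in> p \<longleftrightarrow> left_translate n ?G \<in> p"
        by (rule beta_cong[OF p Z])
          (use n g_add_near_integer[OF _ _ \<epsilon>(2)] in \<open>auto simp: left_translate_def Z_def pos_nats_def\<close>)
      then show ?thesis by (auto simp: image_ultrafilter_def left_translate_def)
    qed
    have "C \<in> ultrafilter_add (image_ultrafilter p) (image_ultrafilter p) \<longleftrightarrow>
        {n \<in> pos_nats. g n \<in> {x \<in> pos_nats. left_translate x C \<in> image_ultrafilter p}} \<in> p"
      using C by (auto simp: ultrafilter_add_def image_ultrafilter_def)
    also have "\<dots> \<longleftrightarrow> {n \<in> pos_nats. left_translate n ?G \<in> p} \<in> p"
      by (rule beta_cong[OF p Z]) (use inner in \<open>auto simp: Z_def pos_nats_def\<close>)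
    also have "\<dots> \<longleftrightarrow> ?G \<in> ultrafilter_add p p" by (auto simp: ultrafilter_add_def)
    also have "\<dots> \<longleftrightarrow> C \<in> image_ultrafilter p" using C by (simp add: idem image_ultrafilter_def)
    finally show ?thesis .
  qed
  moreover have "C \<subseteq> pos_nats" if "C \<in> ultrafilter_add (image_ultrafilter p) (image_ultrafilter p) \<or> C \<in> image_ultrafilter p" for C
    using that by (auto simp: ultrafilter_add_def image_ultrafilter_def)
  ultimately show ?thesis by blast
qed

text \<open>
  The reduction to a statement about a single set. The inclusion \<open>g ` D \<subseteq> C\<close>, in place of an equality,
  lets the hypothesis on \<open>\<F>\<close> cover closure under supersets as well.
\<close>

lemma essential_image:
  assumes pres: "\<And>D C. D \<in> \<F> \<Longrightarrow> D \<subseteq> near_integer (1/4) \<Longrightarrow> g ` D \<subseteq> C \<Longrightarrow> C \<subseteq> pos_nats \<Longrightarrow> C \<in> \<F>"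
    and A: "essential_set \<F> A"
  shows "essential_set \<F> (spectrum_image \<alpha> \<gamma> A)"
proof -
  obtain p where p: "p \<in> beta_pos_nats" and pF: "p \<subseteq> \<F>"
    and idem: "ultrafilter_add p p = p" and Ap: "A \<in> p"
    using A by (auto simp: essential_set_def beta_family_def)
  have "image_ultrafilter p \<subseteq> \<F>"
  proof
    fix C assume C: "C \<in> image_ultrafilter p"
    let ?D = "{n \<in> pos_nats. g n \<in> C} \<inter> near_integer (1/4)"
    have "?D \<in> p"
      using C by (intro beta_Int[OF p] near_integer_in_idempotent[OF p idem]) (simp_all add: image_ultrafilter_def)
    then have "?D \<in> \<F>" using pF by (rule rev_subsetD)
    moreover have "g ` ?D \<subseteq> C" by auto
    moreover have "C \<subseteq> pos_nats" using C by (simp add: image_ultrafilter_def)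
    ultimately show "C \<in> \<F>" using pres[of ?D C] by blast
  qed
  moreover have "spectrum_image \<alpha> \<gamma> A \<in> image_ultrafilter p"
  proof -
    have "A \<inter> {n \<in> pos_nats. g n > 0} \<in> p"
      by (intro beta_Int p Ap g_pos_in_idempotent idem)
    then have "{n \<in> pos_nats. g n \<in> spectrum_image \<alpha> \<gamma> A} \<in> p"
      by (rule beta_upward[OF p]) (auto simp: spectrum_image_def pos_nats_def)
    then show ?thesis by (simp add: image_ultrafilter_def spectrum_image_def)
  qed
  ultimately show ?thesis
    using image_ultrafilter_in_beta[OF p idem] image_ultrafilter_idempotent[OF p idem]
    unfolding essential_set_def beta_family_def by (auto simp: spectrum_image_def)
qed

section \<open>Families preserved by bounded distortion\<close>

lemma IF_preserved:
  assumes "D \<in> IF_sets" "g ` D \<subseteq> C" "C \<subseteq> pos_nats"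
  shows "C \<in> IF_sets"
  using assms finite_of_finite_image[of D] finite_subset[of "g ` D" C] by (auto simp: IF_sets_def)

text \<open>
  Along a progression in \<open>D\<close>, two differences of consecutive values of \<open>g\<close> are integers obtained from
  the same number \<open>\<alpha> d\<close> by four errors below \<open>1/4\<close>, hence equal. Their common value \<open>e\<close> could be \<open>0\<close>;
  this is excluded by starting from a progression with more than \<open>period\<close> terms.
\<close>

lemma AP_preserved:
  assumes D: "D \<in> AP_sets" and near: "D \<subseteq> near_integer (1/4)" and C: "g ` D \<subseteq> C" "C \<subseteq> pos_nats"
  shows "C \<in> AP_sets"
  unfolding AP_sets_def
proof (intro CollectI conjI allI C)
  fix k :: nat
  \<comment> \<open>The term of index \<open>period\<close> is used to show that the image progression is not constant.\<close>
  define K where "K = k + period + 1"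
  have "\<exists>a\<in>pos_nats. \<exists>d\<in>pos_nats. \<forall>i<K. a + i * d \<in> D" using D by (simp add: AP_sets_def)
  then obtain a d where "d \<in> pos_nats" and "\<forall>i<K. a + i * d \<in> D" by blast
  then have d: "d > 0" and ap: "\<And>i. i < K \<Longrightarrow> a + i * d \<in> D"
    by (auto simp: pos_nats_def)
  have err: "\<bar>\<alpha> * real (a + i * d) - real (g (a + i * d))\<bar> < 1/4" if "i < K" for i
    using ap[OF that] near by (auto simp: near_integer_def)
  have "K > 1" using period by (simp add: K_def)
  define e where "e = g (a + d) - g a"
  have e: "g (a + d) = g a + e" using g_mono[of a "a + d"] by (simp add: e_def)
  have prog: "g (a + i * d) = g a + i * e" if "i < K" for i
    using that
  proof (induction i)
    case (Suc i)
    have "\<alpha> * real (a + Suc i * d) - \<alpha> * real (a + i * d) = \<alpha> * real (a + d) - \<alpha> * real a"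
      by (simp add: algebra_simps)
    then have "\<bar>real (g (a + Suc i * d)) - real (g (a + i * d)) - (real (g (a + d)) - real (g a))\<bar> < 1"
      using err[of "Suc i"] err[of i] err[of 0] err[of 1] Suc.prems \<open>K > 1\<close>
      unfolding mult_1 mult_0 add_0_right by linarith
    moreover have "real (g (a + i * d)) = real (g a + i * e)" using Suc by simp
    ultimately have "\<bar>real (g (a + Suc i * d)) - real (g a + Suc i * e)\<bar> < 1"
      unfolding e by (simp add: algebra_simps)
    then show ?case by linarith
  qed simp
  have "e > 0"
  proof (rule ccontr)
    assume "\<not> e > 0"
    then have "g (a + period * d) = g a" using prog[of period] by (simp add: K_def)
    with g_shift_period[of a d] d show False by simp
  qed
  moreover have "g a > 0"
  proof -
    have "a \<in> D" using ap[of 0] \<open>K > 1\<close> by simp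
    then have "g a \<in> pos_nats" using C by blast
    then show ?thesis by (simp add: pos_nats_def)
  qed
  moreover have "g a + i * e \<in> C" if "i < k" for i
  proof -
    have "i < K" using that by (simp add: K_def)
    then show ?thesis using prog[of i] ap[of i] C by auto
  qed
  ultimately have "g a \<in> pos_nats" "e \<in> pos_nats" "\<forall>i<k. g a + i * e \<in> C"
    by (simp_all add: pos_nats_def)
  then show "\<exists>a\<in>pos_nats. \<exists>d\<in>pos_nats. \<forall>i<k. a + i * d \<in> C" by blast
qed

text \<open>
  For each \<open>y\<close> in a long interval after \<open>x\<close>, the set \<open>D\<close> has an element in \<open>{y + 1..y + b}\<close>, where \<open>b\<close>
  bounds the translations that witness piecewise syndeticity. For \<open>z\<close> between the values of \<open>g\<close> at its ends,
  take the least \<open>y\<close> with \<open>g y > z\<close>. The element of \<open>D\<close> following \<open>y\<close> has an image above \<open>z\<close>, and the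
  image exceeds \<open>g (y - 1) \<le> z\<close> by at most \<open>\<alpha> (b + 1) + 1\<close>.
\<close>

lemma PS_preserved:
  assumes D: "D \<in> PS_sets" and C: "g ` D \<subseteq> C" "C \<subseteq> pos_nats"
  shows "C \<in> PS_sets"
proof -
  obtain G where G: "G \<in> fin_subsets pos_nats"
    and PS: "\<And>F. F \<in> fin_subsets pos_nats \<Longrightarrow>
      \<exists>x\<in>pos_nats. (\<lambda>s. s + x) ` F \<subseteq> (\<Union>t\<in>G. left_translate t D)"
    using D by (auto simp: PS_sets_def)
  define b where "b = Max G"
  have b: "t \<le> b" if "t \<in> G" for t using G that by (simp add: b_def fin_subsets_def)
  define b' where "b' = nat \<lceil>\<alpha> * real (b + 1) + 1\<rceil>"
  have b': "\<alpha> * real (b + 1) + 1 \<le> real b'" unfolding b'_def by linarith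
  have "\<alpha> * real (b + 1) > 0" using \<alpha> by simp
  then have "b' > 0" using b' by linarith
  have "\<exists>x\<in>pos_nats. (\<lambda>s. s + x) ` F \<subseteq> (\<Union>t\<in>{1..b'}. left_translate t C)"
    if F: "F \<in> fin_subsets pos_nats" for F
  proof -
    define N where "N = Max F"
    have N: "s \<le> N" if "s \<in> F" for s using F that by (simp add: N_def fin_subsets_def)
    \<comment> \<open>Long enough for \<open>g\<close> to climb beyond \<open>g (x + 1) + 1 + N\<close>.\<close>
    define L where "L = 1 + period * (N + 2)"
    have "{1..L} \<in> fin_subsets pos_nats" by (auto simp: L_def fin_subsets_def pos_nats_def)
    from PS[OF this] obtain x where
      sub: "(\<lambda>s. s + x) ` {1..L} \<subseteq> (\<Union>t\<in>G. left_translate t D)" by blast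
    have x: "\<exists>t\<in>G. t + (s + x) \<in> D" if "1 \<le> s" "s \<le> L" for s
    proof -
      have "s \<in> {1..L}" using that by simp
      then have "s + x \<in> (\<Union>t\<in>G. left_translate t D)" using sub by blast
      then show ?thesis by (auto simp: left_translate_def)
    qed
    define x' where "x' = g (x + 1) + 1"
    have "s + x' \<in> (\<Union>t\<in>{1..b'}. left_translate t C)" if s: "s \<in> F" for s
    proof -
      define z where "z = s + x'"
      define y where "y = (LEAST y. g y > z)"
      have "g (x + L) > z"
        using g_shift_period[of "x + 1" "N + 2"] N[OF s] by (simp add: L_def z_def x'_def)
      then have y: "g y > z" "y \<le> x + L" unfolding y_def by (rule LeastI, rule Least_le)
      have "y > x + 1"
      proof (rule ccontr)
        assume "\<not> y > x + 1"
        then have "g y \<le> g (x + 1)" by (intro g_mono) simp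
        then show False using y by (simp add: z_def x'_def)
      qed
      have "\<not> g (y - 1) > z"
        using not_less_Least[of "y - 1" "\<lambda>y. g y > z"] \<open>y > x + 1\<close> by (simp add: y_def)
      have "1 \<le> y - x" "y - x \<le> L" "(y - x) + x = y" using y \<open>y > x + 1\<close> by linarith+
      with x[of "y - x"] obtain t where t: "t \<in> G" "t + y \<in> D" by auto
      have "g y \<le> g (t + y)" by (intro g_mono) simp
      moreover have "real (g (t + y)) \<le> real z + real b'"
      proof -
        have "\<alpha> * real (t + y) \<le> \<alpha> * real (y - 1) + \<alpha> * real (b + 1)"
          using b[OF t(1)] \<open>y > x + 1\<close> \<alpha>
          by (subst distrib_left[symmetric], intro mult_left_mono) auto
        then show ?thesis
          using g_bounds(1)[of "t + y"] g_bounds(2)[of "y - 1"] b' \<open>\<not> g (y - 1) > z\<close> by linarith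
      qed
      ultimately have "g (t + y) - z \<in> {1..b'}" "(g (t + y) - z) + z = g (t + y)"
        using y by auto
      moreover have "g (t + y) \<in> C" using t C by auto
      ultimately show ?thesis
        by (intro UN_I[of "g (t + y) - z"]) (auto simp: left_translate_def z_def x'_def pos_nats_def)
    qed
    then show ?thesis by (intro bexI[of _ x']) (auto simp: x'_def pos_nats_def)
  qed
  moreover have "{1..b'} \<in> fin_subsets pos_nats"
    using \<open>b' > 0\<close> by (auto simp: fin_subsets_def pos_nats_def)
  ultimately show ?thesis using C by (auto simp: PS_sets_def)
qed

text \<open>
  Since \<open>g n \<le> (\<alpha> + 1) n\<close>, the term \<open>1/n\<close> is at most \<open>(\<alpha> + 1) / g n\<close>, and each value of \<open>g\<close> is
  counted at most \<open>period\<close> times. So the harmonic sum over \<open>D\<close> is at most a constant times the one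
  over \<open>C\<close>.
\<close>

lemma HSD_preserved:
  assumes D: "D \<in> HSD_sets" and C: "g ` D \<subseteq> C" "C \<subseteq> pos_nats"
  shows "C \<in> HSD_sets"
proof -
  let ?w = "\<lambda>n. ennreal (1 / real n)"
  define c where "c = ennreal ((\<alpha> + 1) * real period)"
  have "infsum ?w D \<le> c * infsum ?w C"
  proof (rule infsum_le_finite_sums)
    fix E assume E: "finite E" "E \<subseteq> D"
    let ?S = "g ` E"
    have pos: "n > 0" "g n > 0" if "n \<in> E" for n
    proof -
      have "n \<in> pos_nats" using that E D by (auto simp: HSD_sets_def)
      then show "n > 0" by (simp add: pos_nats_def)
      have "g n \<in> pos_nats" using that E C by blast
      then show "g n > 0" by (simp add: pos_nats_def)
    qed
    have "(\<Sum>n\<in>E. 1 / real n) \<le> (\<Sum>n\<in>E. (\<alpha> + 1) / real (g n))"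
      using pos g_le by (intro sum_mono) (simp add: field_simps)
    also have "\<dots> = (\<Sum>z\<in>(\<lambda>n. (g n, n mod period)) ` E. (\<alpha> + 1) / real (fst z))"
      by (subst sum.reindex[OF inj_on_subset[OF inj_g_mod subset_UNIV]]) simp
    also have "\<dots> \<le> (\<Sum>z\<in>?S \<times> {..<period}. (\<alpha> + 1) / real (fst z))"
      using E \<alpha> period by (intro sum_mono2) auto
    also have "\<dots> = (\<alpha> + 1) * real period * (\<Sum>m\<in>?S. 1 / real m)"
      by (simp add: sum.cartesian_product' sum_distrib_left mult_ac)
    finally have "sum ?w E \<le> c * sum ?w ?S"
      using \<alpha> by (simp add: c_def sum_ennreal sum_nonneg flip: ennreal_mult)
    also have "sum ?w ?S = infsum ?w ?S" using E by simp
    also have "\<dots> \<le> infsum ?w C"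
      using E C by (intro infsum_mono_neutral nonneg_summable_on_complete) auto
    finally show "sum ?w E \<le> c * infsum ?w C" by (simp add: mult_left_mono)
  qed (auto intro: nonneg_summable_on_complete)
  then have "c * infsum ?w C = \<infinity>" using D by (simp add: HSD_sets_def top.extremum_unique)
  then have "infsum ?w C = \<infinity>" by (simp add: c_def ennreal_mult_eq_top_iff)
  then show ?thesis using C by (simp add: HSD_sets_def)
qed

end

section \<open>Families defined by densities\<close>

lemma Limsup_pos_iff_frequently:
  "0 < Limsup F (\<lambda>x. ereal (r x)) \<longleftrightarrow> (\<exists>c>0. \<exists>\<^sub>F x in F. c \<le> r x)"
proof
  assume "0 < Limsup F (\<lambda>x. ereal (r x))"
  then obtain c where c: "0 < ereal c" "ereal c < Limsup F (\<lambda>x. ereal (r x))"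
    using ereal_dense2 by blast
  have "\<exists>\<^sub>F x in F. c \<le> r x"
  proof (rule ccontr)
    assume "\<not> (\<exists>\<^sub>F x in F. c \<le> r x)"
    then have "\<forall>\<^sub>F x in F. ereal (r x) \<le> ereal c"
      unfolding not_frequently by eventually_elim simp
    from Limsup_bounded[OF this] c show False by simp
  qed
  with c show "\<exists>c>0. \<exists>\<^sub>F x in F. c \<le> r x" by auto
next
  assume "\<exists>c>0. \<exists>\<^sub>F x in F. c \<le> r x"
  then obtain c where c: "c > 0" "\<exists>\<^sub>F x in F. c \<le> r x" by blast
  show "0 < Limsup F (\<lambda>x. ereal (r x))"
  proof (rule ccontr)
    assume "\<not> 0 < Limsup F (\<lambda>x. ereal (r x))"
    then have "Limsup F (\<lambda>x. ereal (r x)) < ereal c"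
      using c by (metis ereal_less(2) le_less_trans not_less)
    from Limsup_lessD[OF this] have "\<forall>\<^sub>F x in F. \<not> c \<le> r x" by eventually_elim simp
    with c show False by (simp add: frequently_def)
  qed
qed

lemma upper_density_pos_iff:
  "upper_density A > 0 \<longleftrightarrow>
    (\<exists>c>0. \<forall>N. \<exists>n\<ge>N. c \<le> real (card (A \<inter> {1..n})) / real n)"
  by (simp add: upper_density_def Limsup_pos_iff_frequently frequently_sequentially)

lemma upper_Banach_density_pos_iff:
  "upper_Banach_density A > 0 \<longleftrightarrow>
    (\<exists>c>0. \<forall>k. \<exists>m\<in>pos_nats. \<exists>n\<in>pos_nats. k \<le> int n - int m \<and>
      c \<le> real (card (A \<inter> {m+1..n})) / (real n - real m))"
  unfolding upper_Banach_density_def case_prod_unfold Limsup_pos_iff_frequently frequently_def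
    eventually_inf_principal eventually_filtercomap_at_top_linorder
  by (simp add: split_paired_Ex Bex_def) (meson not_le)

context spectrum
begin

text \<open>
  The elements of \<open>D\<close> up to \<open>n\<close> have at least a fraction \<open>1 / period\<close> as many images, all in \<open>C\<close> and
  at most \<open>g n \<le> (\<alpha> + 1) n\<close>.
\<close>

lemma PUAD_preserved:
  assumes D: "D \<in> PUAD_sets" and C: "g ` D \<subseteq> C" "C \<subseteq> pos_nats"
  shows "C \<in> PUAD_sets"
proof -
  obtain c where c: "c > 0"
    and dens: "\<And>N. \<exists>n\<ge>N. c \<le> real (card (D \<inter> {1..n})) / real n"
    using D by (auto simp: PUAD_sets_def upper_density_pos_iff)
  define c' where "c' = c / (real period * (\<alpha> + 1))"
  have "c' > 0" using c \<alpha> period by (simp add: c'_def)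
  moreover have "\<exists>n\<ge>N. c' \<le> real (card (C \<inter> {1..n})) / real n" for N
  proof -
    obtain n where n: "n \<ge> period * (N + 1)" and le: "c \<le> real (card (D \<inter> {1..n})) / real n"
      using dens by blast
    have "n > 0" using n period by (cases "n = 0") auto
    have "N + 1 \<le> g (0 + period * (N + 1))" using g_shift_period[of 0 "N + 1"] by linarith
    also have "\<dots> \<le> g n" using n by (intro g_mono) simp
    finally have gn: "N < g n" by simp
    have "g ` (D \<inter> {1..n}) \<subseteq> C \<inter> {1..g n}"
      using C g_mono by (fastforce simp: pos_nats_def image_subset_iff)
    then have "card (D \<inter> {1..n}) \<le> period * card (C \<inter> {1..g n})"
      by (intro card_le_period_mult_image) auto
    then have "real (card (D \<inter> {1..n})) \<le> real period * real (card (C \<inter> {1..g n}))"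
      by (simp only: of_nat_le_iff flip: of_nat_mult)
    moreover have "c * real n \<le> real (card (D \<inter> {1..n}))"
      using le \<open>n > 0\<close> by (simp add: field_simps)
    moreover have "c' * real (g n) * real period \<le> c * real n"
    proof -
      have "c' * real (g n) * real period \<le> c' * ((\<alpha> + 1) * real n) * real period"
        using g_le[OF \<open>n > 0\<close>] \<open>c' > 0\<close> by (intro mult_right_mono mult_left_mono) auto
      also have "\<dots> = c * real n" using \<alpha> period by (simp add: c'_def)
      finally show ?thesis .
    qed
    ultimately have "c' * real (g n) * real period \<le> real (card (C \<inter> {1..g n})) * real period"
      by (simp add: mult.commute)
    then have "c' * real (g n) \<le> real (card (C \<inter> {1..g n}))"
      using period by simp
    then show ?thesis using gn by (intro exI[of _ "g n"]) (auto simp: field_simps)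
  qed
  ultimately show ?thesis using C by (auto simp: PUAD_sets_def upper_density_pos_iff)
qed

text \<open>
  The elements of \<open>D\<close> in \<open>{m + 1..n}\<close> have images in \<open>{g m..g n}\<close>. The left end of the interval used for
  \<open>C\<close> is \<open>m' = g m + 1\<close> and not \<open>g m\<close>, which could be \<open>0\<close>; the at most two values lost in
  this way are absorbed by halving the density when \<open>n - m\<close> is large.
\<close>

lemma PUBD_preserved:
  assumes D: "D \<in> PUBD_sets" and C: "g ` D \<subseteq> C" "C \<subseteq> pos_nats"
  shows "C \<in> PUBD_sets"
proof -
  obtain c where c: "c > 0"
    and dens: "\<And>k. \<exists>m\<in>pos_nats. \<exists>n\<in>pos_nats. k \<le> int n - int m \<and>
      c \<le> real (card (D \<inter> {m+1..n})) / (real n - real m)"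
    using D by (auto simp: PUBD_sets_def upper_Banach_density_pos_iff)
  define M where "M = real period"
  have M: "M > 0" using period by (simp add: M_def)
  define c' where "c' = c / (2 * M * \<alpha>)"
  have "c' > 0" using c \<alpha> M by (simp add: c'_def)
  moreover have "\<exists>m\<in>pos_nats. \<exists>n\<in>pos_nats. k \<le> int n - int m \<and>
      c' \<le> real (card (C \<inter> {m+1..n})) / (real n - real m)" for k :: int
  proof -
    \<comment> \<open>The first bound makes the two lost values negligible, the second one keeps \<open>n' - m'\<close> above \<open>k\<close> and \<open>1\<close>.\<close>
    define k' where "k' = \<lceil>max (4 * M / c) ((max 1 (real_of_int k) + 2) / \<alpha>)\<rceil>"
    obtain m n where k': "k' \<le> int n - int m"
      and le: "c \<le> real (card (D \<inter> {m+1..n})) / (real n - real m)"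
      using dens by blast
    define l where "l = real n - real m"
    have "max (4 * M / c) ((max 1 (real_of_int k) + 2) / \<alpha>) \<le> l"
      using k' unfolding k'_def l_def by linarith
    then have l: "4 * M \<le> c * l" "max 1 (real_of_int k) + 2 \<le> \<alpha> * l"
      using c \<alpha> by (auto simp: field_simps)
    have "l > 0" using l(2) \<alpha> by (smt (verit) mult_nonneg_nonpos)
    define m' n' where "m' = g m + 1" and "n' = g n"
    have diff: "\<alpha> * l - 2 < real n' - real m'" "real n' - real m' < \<alpha> * l"
      using g_bounds[of m] g_bounds[of n] by (auto simp: m'_def n'_def l_def right_diff_distrib)
    have "g ` (D \<inter> {m+1..n}) \<subseteq> (C \<inter> {m'+1..n'}) \<union> {g m, g m + 1}"
    proof
      fix z assume "z \<in> g ` (D \<inter> {m+1..n})"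
      then obtain d where d: "z = g d" "d \<in> D" "m \<le> d" "d \<le> n" by auto
      then have "g m \<le> z" "z \<le> g n" "z \<in> C" using g_mono C by auto
      then show "z \<in> (C \<inter> {m'+1..n'}) \<union> {g m, g m + 1}" by (auto simp: m'_def n'_def)
    qed
    then have "card (D \<inter> {m+1..n}) \<le> period * card ((C \<inter> {m'+1..n'}) \<union> {g m, g m + 1})"
      by (intro card_le_period_mult_image) auto
    also have "\<dots> \<le> period * (card (C \<inter> {m'+1..n'}) + card {g m, g m + 1})"
      by (intro mult_left_mono card_Un_le) simp
    also have "card {g m, g m + 1} = 2" by simp
    finally have "real (card (D \<inter> {m+1..n})) \<le> real (period * (card (C \<inter> {m'+1..n'}) + 2))"
      by (simp only: of_nat_le_iff)
    then have "real (card (D \<inter> {m+1..n})) \<le> M * (real (card (C \<inter> {m'+1..n'})) + 2)"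
      by (simp only: of_nat_mult of_nat_add of_nat_numeral M_def)
    moreover have "c * l \<le> real (card (D \<inter> {m+1..n}))"
      using le \<open>l > 0\<close> by (simp add: field_simps l_def)
    ultimately have "c * l / 2 \<le> M * real (card (C \<inter> {m'+1..n'}))"
      using l(1) by (simp add: algebra_simps)
    moreover have "c' * (real n' - real m') * M \<le> c * l / 2"
    proof -
      have "c' * (real n' - real m') * M \<le> c' * (\<alpha> * l) * M"
        using diff \<open>c' > 0\<close> M by (intro mult_right_mono mult_left_mono) auto
      also have "\<dots> = c * l / 2" using \<alpha> M by (simp add: c'_def)
      finally show ?thesis .
    qed
    ultimately have "c' * (real n' - real m') * M \<le> real (card (C \<inter> {m'+1..n'})) * M"
      by (simp add: mult.commute)
    then have "c' * (real n' - real m') \<le> real (card (C \<inter> {m'+1..n'}))" using M by simp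
    moreover have "real n' - real m' > max 1 (real_of_int k)" using diff l by linarith
    moreover from this have "k \<le> int n' - int m'" by linarith
    ultimately have "k \<le> int n' - int m'"
      "c' \<le> real (card (C \<inter> {m'+1..n'})) / (real n' - real m')"
      by (auto simp: pos_le_divide_eq)
    moreover have "m' \<in> pos_nats" "n' \<in> pos_nats"
      using \<open>real n' - real m' > max 1 (real_of_int k)\<close> by (auto simp: pos_nats_def m'_def)
    ultimately show ?thesis by blast
  qed
  ultimately show ?thesis using C by (auto simp: PUBD_sets_def upper_Banach_density_pos_iff)
qed

end

section \<open>\<open>J\<close>-sets\<close>

text \<open>
  Two partial sums that fall, for every \<open>f \<in> F\<close>, into the same arc of the circle differ by a
  block sum close to an integer. Such a pair exists because there are only finitely many products of
  arcs.
\<close>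

lemma block_sums_near_integers:
  fixes x :: "'a \<Rightarrow> nat \<Rightarrow> real"
  assumes F: "finite F" and "\<delta> > 0"
  shows "\<exists>l u. k \<le> l \<and> l < u \<and> (\<forall>f\<in>F. \<exists>j::int. \<bar>(\<Sum>i\<in>{l<..u}. x f i) - of_int j\<bar> < \<delta>)"
proof -
  obtain K :: nat where K: "K > 0" "1 / real K < \<delta>"
    using \<open>\<delta> > 0\<close> by (metis nat_approx_posE zero_less_Suc)
  define S where "S f n = (\<Sum>i\<le>n. x f i)" for f n
  define box where "box n = (\<lambda>f\<in>F. \<lfloor>real K * frac (S f n)\<rfloor>)" for n
  have "box ` {k..} \<subseteq> (\<Pi>\<^sub>E f\<in>F. {0..<int K})"
    unfolding box_def using floor_mult_frac_in[OF K(1)] by (intro image_subsetI restrict_PiE_iff[THEN iffD2]) simp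
  moreover have "finite (\<Pi>\<^sub>E f\<in>F. {0..<int K})" using F by (intro finite_PiE) auto
  ultimately have "finite (box ` {k..})" by (rule finite_subset)
  then have "\<not> inj_on box {k..}" using finite_imageD infinite_Ici by blast
  then obtain m n where "k \<le> m" "k \<le> n" "box m = box n" "m \<noteq> n" by (auto simp: inj_on_def)
  then obtain l u where lu: "k \<le> l" "l < u" "box u = box l"
    by (metis linorder_neqE_nat)
  have "\<exists>j::int. \<bar>(\<Sum>i\<in>{l<..u}. x f i) - of_int j\<bar> < \<delta>" if "f \<in> F" for f
  proof -
    have "{..u} - {..l} = {l<..u}" by auto
    then have sum: "(\<Sum>i\<in>{l<..u}. x f i) = S f u - S f l"
      unfolding S_def using lu(2) sum_diff[of "{..u}" "{..l}" "x f"] by auto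
    have "\<lfloor>real K * frac (S f u)\<rfloor> = \<lfloor>real K * frac (S f l)\<rfloor>"
      using fun_cong[OF lu(3), of f] that by (simp add: box_def)
    from abs_diff_less_of_floor_mult_eq[OF this] K
    have "\<bar>frac (S f u) - frac (S f l)\<bar> < \<delta>" by simp
    then have "\<bar>(\<Sum>i\<in>{l<..u}. x f i) - of_int (\<lfloor>S f u\<rfloor> - \<lfloor>S f l\<rfloor>)\<bar> < \<delta>"
      unfolding sum by (simp add: frac_def algebra_simps)
    then show ?thesis by blast
  qed
  with lu show ?thesis by blast
qed

lemma disjoint_blocks_near_integers:
  fixes x :: "'a \<Rightarrow> nat \<Rightarrow> real" and \<delta> :: "nat \<Rightarrow> real"
  assumes "finite F" and "\<And>n. \<delta> n > 0"
  shows "\<exists>B :: nat \<Rightarrow> nat set. (\<forall>n. B n \<in> fin_subsets pos_nats) \<and> disjoint_family B \<and>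
    (\<forall>n. \<forall>f\<in>F. \<exists>j::int. \<bar>(\<Sum>i\<in>B n. x f i) - of_int j\<bar> < \<delta> n)"
proof -
  define P where "P n b \<longleftrightarrow> fst b < snd b \<and>
    (\<forall>f\<in>F. \<exists>j::int. \<bar>(\<Sum>i\<in>{fst b<..snd b}. x f i) - of_int j\<bar> < \<delta> n)" for n b
  have next_block: "\<exists>b. P n b \<and> k \<le> fst b" for n k
  proof -
    obtain l u where "k \<le> l" "l < u"
      "\<forall>f\<in>F. \<exists>j::int. \<bar>(\<Sum>i\<in>{l<..u}. x f i) - of_int j\<bar> < \<delta> n"
      using block_sums_near_integers[OF assms, of k x n] by blast
    then show ?thesis by (intro exI[of _ "(l, u)"]) (simp add: P_def)
  qed
  have "\<exists>b. \<forall>n. P n (b n) \<and> snd (b n) \<le> fst (b (Suc n))"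
    by (rule dependent_nat_choice) (use next_block in blast)+
  then obtain b where b: "\<And>n. P n (b n)" and step: "\<And>n. snd (b n) \<le> fst (b (Suc n))" by blast
  have ord: "fst (b n) < snd (b n)" for n using b[of n] by (simp add: P_def)
  have le: "snd (b m) \<le> fst (b n)" if "m < n" for m n
    using that
  proof (induction n)
    case (Suc n)
    show ?case
    proof (cases "m = n")
      case False
      then have "snd (b m) \<le> fst (b n)" using Suc by simp
      then show ?thesis using ord[of n] step[of n] by linarith
    qed (use step in simp)
  qed simp
  have disj: "{fst (b m)<..snd (b m)} \<inter> {fst (b n)<..snd (b n)} = {}" if "m \<noteq> n" for m n
    using le[of m n] le[of n m] that by (cases "m < n") auto
  show ?thesis
  proof (intro exI[of _ "\<lambda>n. {fst (b n)<..snd (b n)}"] conjI allI)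
    show "{fst (b n)<..snd (b n)} \<in> fin_subsets pos_nats" for n
      using ord[of n] by (auto simp: fin_subsets_def pos_nats_def)
    show "disjoint_family (\<lambda>n. {fst (b n)<..snd (b n)})"
      using disj by (auto simp: disjoint_family_on_def)
    show "\<forall>f\<in>F. \<exists>j::int. \<bar>(\<Sum>i\<in>{fst (b n)<..snd (b n)}. x f i) - of_int j\<bar> < \<delta> n" for n
      using b[of n] by (simp add: P_def)
  qed
qed

lemma sum_half_powers_le_1:
  assumes "finite H" "H \<subseteq> pos_nats"
  shows "(\<Sum>n\<in>H. (1/2::real) ^ n) \<le> 1"
proof -
  have *: "(\<Sum>n=1..N. (1/2::real) ^ n) = 1 - (1/2) ^ N" for N
    by (induction N) auto
  have "H \<subseteq> {1..Max H}" using assms by (auto simp: pos_nats_def Suc_le_eq)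
  then have "(\<Sum>n\<in>H. (1/2::real) ^ n) \<le> (\<Sum>n=1..Max H. (1/2) ^ n)"
    by (intro sum_mono2) auto
  also have "\<dots> \<le> 1" unfolding * by simp
  finally show ?thesis .
qed

context spectrum
begin

text \<open>
  Let \<open>T f n\<close> be the integer nearest to the sum of \<open>(f i + M) / \<alpha>\<close> over the block \<open>B n\<close>, where the
  blocks are chosen so that all rounding errors, multiplied by \<open>\<alpha>\<close>, add up to at most \<open>1/4\<close>. If
  \<open>v f = a + (\<Sum>n\<in>H. T f n)\<close> lies in \<open>D\<close> for all \<open>f\<close>, then \<open>g (v f)\<close> is within \<open>1/4\<close> of \<open>\<alpha> (v f)\<close>, and so
  within \<open>1/2\<close> of \<open>\<alpha> a\<close> plus the sum of \<open>f i + M\<close> over the union \<open>H'\<close> of the blocks. The difference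
  between \<open>g (v f)\<close> and that sum is an integer in an open interval of length \<open>1\<close>, hence the same
  integer \<open>c\<close> for every \<open>f\<close>.
  
  The summand \<open>M \<ge> \<alpha>\<close> serves two purposes. It makes \<open>T f n\<close> positive, and it contributes the
  positive amount \<open>card H' * M\<close> to the translation \<open>a'\<close>, for \<open>c\<close> by itself may be \<open>0\<close> when \<open>\<alpha> a\<close> is
  small.
\<close>

lemma J_preserved:
  assumes D: "D \<in> J_sets" and near: "D \<subseteq> near_integer (1/4)" and C: "g ` D \<subseteq> C" "C \<subseteq> pos_nats"
  shows "C \<in> J_sets"
proof -
  have "\<exists>a\<in>pos_nats. \<exists>H\<in>fin_subsets pos_nats. \<forall>f\<in>F. a + (\<Sum>n\<in>H. f n) \<in> C"
    if F: "F \<in> fin_subsets (pos_nats \<rightarrow> pos_nats)" for F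
  proof -
    have "finite F" "F \<noteq> {}" using F by (auto simp: fin_subsets_def)
    define M where "M = nat \<lceil>\<alpha>\<rceil>"
    have M: "\<alpha> \<le> real M" "M > 0" using \<alpha> unfolding M_def by linarith+
    define X where "X f B = (\<Sum>i\<in>B. real (f i + M) / \<alpha>)" for f :: "nat \<Rightarrow> nat" and B
    have X: "\<alpha> * X f B = real (\<Sum>i\<in>B. f i + M)" for f B
      using \<alpha> by (simp add: X_def sum_divide_distrib[symmetric])
    have "\<exists>B :: nat \<Rightarrow> nat set. (\<forall>n. B n \<in> fin_subsets pos_nats) \<and> disjoint_family B \<and>
        (\<forall>n. \<forall>f\<in>F. \<exists>j::int. \<bar>X f (B n) - of_int j\<bar> < (1/2) ^ n / (4 * \<alpha>))"
      unfolding X_def using \<alpha> by (intro disjoint_blocks_near_integers \<open>finite F\<close>) simp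
    then obtain B :: "nat \<Rightarrow> nat set" where B: "\<And>n. B n \<in> fin_subsets pos_nats"
      and disj: "disjoint_family B"
      and approx: "\<And>n f. f \<in> F \<Longrightarrow> \<exists>j::int. \<bar>X f (B n) - of_int j\<bar> < (1/2) ^ n / (4 * \<alpha>)"
      by blast
    define T where "T f n = nat (round (X f (B n)))" for f n
    have T: "T f n > 0" "\<bar>\<alpha> * real (T f n) - real (\<Sum>i\<in>B n. f i + M)\<bar> \<le> (1/2) ^ n / 4"
      if f: "f \<in> F" for f n
    proof -
      obtain i where i: "i \<in> B n" "finite (B n)" using B[of n] by (auto simp: fin_subsets_def)
      have "1 \<le> real (f i + M) / \<alpha>" using M \<alpha> by (simp add: field_simps)
      also have "\<dots> \<le> X f (B n)"
        unfolding X_def using i \<alpha> by (intro member_le_sum) auto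
      finally have "round (X f (B n)) \<ge> 1" using round_mono[of 1 "X f (B n)"] by simp
      then show "T f n > 0" by (simp add: T_def)
      have rT: "real (T f n) = of_int (round (X f (B n)))"
        using \<open>round (X f (B n)) \<ge> 1\<close> by (simp add: T_def)
      obtain j :: int where j: "\<bar>X f (B n) - of_int j\<bar> < (1/2) ^ n / (4 * \<alpha>)"
        using approx[OF f] by blast
      have "\<bar>X f (B n) - real (T f n)\<bar> \<le> (1/2) ^ n / (4 * \<alpha>)"
        unfolding rT using round_diff_minimal[of "X f (B n)" j] j by linarith
      then have "\<alpha> * \<bar>X f (B n) - real (T f n)\<bar> \<le> \<alpha> * ((1/2) ^ n / (4 * \<alpha>))"
        using \<alpha> by (intro mult_left_mono) auto
      moreover have "\<alpha> * \<bar>X f (B n) - real (T f n)\<bar>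
          = \<bar>\<alpha> * real (T f n) - real (\<Sum>i\<in>B n. f i + M)\<bar>"
        using \<alpha> unfolding X[symmetric] right_diff_distrib[symmetric] by (simp add: abs_mult abs_minus_commute)
      ultimately show "\<bar>\<alpha> * real (T f n) - real (\<Sum>i\<in>B n. f i + M)\<bar> \<le> (1/2) ^ n / 4"
        using \<alpha> by simp
    qed
    have "T f \<in> pos_nats \<rightarrow> pos_nats" if "f \<in> F" for f
      using T(1)[OF that] by (simp add: pos_nats_def Pi_def)
    then have "T ` F \<in> fin_subsets (pos_nats \<rightarrow> pos_nats)"
      using \<open>finite F\<close> \<open>F \<noteq> {}\<close> unfolding fin_subsets_def by blast
    then have "\<exists>a\<in>pos_nats. \<exists>H\<in>fin_subsets pos_nats. \<forall>h\<in>T ` F. a + (\<Sum>n\<in>H. h n) \<in> D"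
      using D by (auto simp only: J_sets_def mem_Collect_eq dest: bspec)
    then obtain a H where H: "H \<in> fin_subsets pos_nats"
      and aH: "\<forall>h\<in>T ` F. a + (\<Sum>n\<in>H. h n) \<in> D" by blast
    define H' where "H' = (\<Union>n\<in>H. B n)"
    have H': "H' \<in> fin_subsets pos_nats" using H B by (fastforce simp: H'_def fin_subsets_def)
    define v where "v f = a + (\<Sum>n\<in>H. T f n)" for f
    define s where "s f = (\<Sum>i\<in>H'. f i + M)" for f
    have s: "s f = (\<Sum>n\<in>H. \<Sum>i\<in>B n. f i + M)" for f
      unfolding s_def H'_def using H B disj
      by (intro sum.UNION_disjoint) (auto simp: fin_subsets_def disjoint_family_on_def)
    have close: "\<bar>real (g (v f)) - real (s f) - \<alpha> * real a\<bar> < 1/2" if "f \<in> F" for f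
    proof -
      have "\<alpha> * real (v f) - \<alpha> * real a - real (s f)
          = (\<Sum>n\<in>H. \<alpha> * real (T f n) - real (\<Sum>i\<in>B n. f i + M))"
        by (simp add: v_def s sum_subtractf distrib_left sum_distrib_left)
      also have "\<bar>\<dots>\<bar> \<le> (\<Sum>n\<in>H. (1/2) ^ n / 4)"
        by (rule order_trans[OF sum_abs]) (intro sum_mono T that)
      also have "\<dots> \<le> 1/4"
        using sum_half_powers_le_1[of H] H by (simp add: sum_divide_distrib[symmetric] fin_subsets_def)
      finally have "\<bar>\<alpha> * real (v f) - \<alpha> * real a - real (s f)\<bar> \<le> 1/4" .
      moreover have "v f \<in> near_integer (1/4)" using aH that near by (auto simp: v_def)
      then have "\<bar>\<alpha> * real (v f) - real (g (v f))\<bar> < 1/4" by (simp add: near_integer_def)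
      ultimately show ?thesis by linarith
    qed
    obtain f0 where "f0 \<in> F" using \<open>F \<noteq> {}\<close> by blast
    define c where "c = int (g (v f0)) - int (s f0)"
    have c: "int (g (v f)) = c + int (s f)" if "f \<in> F" for f
      using close[OF that] close[OF \<open>f0 \<in> F\<close>] unfolding c_def by linarith
    have "\<alpha> * real a \<ge> 0" using \<alpha> by simp
    then have "c \<ge> 0" using close[OF \<open>f0 \<in> F\<close>] unfolding c_def by linarith
    define a' where "a' = nat c + card H' * M"
    have "card H' > 0" using H' by (simp add: fin_subsets_def card_gt_0_iff)
    then have "a' \<in> pos_nats" using M by (simp add: a'_def pos_nats_def)
    moreover have "a' + (\<Sum>n\<in>H'. f n) \<in> C" if "f \<in> F" for f
    proof -
      have "s f = (\<Sum>n\<in>H'. f n) + card H' * M" by (simp add: s_def sum.distrib)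
      then have "g (v f) = a' + (\<Sum>n\<in>H'. f n)"
        using c[OF that] \<open>c \<ge> 0\<close> unfolding a'_def by linarith
      moreover have "v f \<in> D" using aH that by (simp add: v_def)
      ultimately show ?thesis using C by (metis image_subset_iff)
    qed
    ultimately show ?thesis using H' by blast
  qed
  then show ?thesis using C by (simp add: J_sets_def)
qed

end

section \<open>Images of essential sets\<close>

theorem corollary3p6:
  fixes \<alpha> \<gamma> :: real and \<F> :: "nat set set" and A :: "nat set"
  assumes "\<alpha> > 0"
    and "0 < \<gamma>" and "\<gamma> < 1"
    and "\<F> \<in> {IF_sets, AP_sets, PS_sets, HSD_sets, J_sets, PUAD_sets, PUBD_sets}"
    and "essential_set \<F> A"
  shows "essential_set \<F> (spectrum_image \<alpha> \<gamma> A)"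
proof -
  interpret spectrum \<alpha> \<gamma> using assms by unfold_locales
  show ?thesis
  proof (rule essential_image[OF _ assms(5)])
    fix D C
    assume D: "D \<in> \<F>" "D \<subseteq> near_integer (1/4)" "g ` D \<subseteq> C" "C \<subseteq> pos_nats"
    consider "\<F> = IF_sets" | "\<F> = AP_sets" | "\<F> = PS_sets" | "\<F> = HSD_sets"
      | "\<F> = J_sets" | "\<F> = PUAD_sets" | "\<F> = PUBD_sets"
      using assms(4) unfolding insert_iff empty_iff by argo
    then show "C \<in> \<F>"
      by cases (use D IF_preserved[of D C] AP_preserved[of D C] PS_preserved[of D C]
          HSD_preserved[of D C] J_preserved[of D C] PUAD_preserved[of D C] PUBD_preserved[of D C]
          in simp_all)
  qed
qed

end
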